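(* Let $H$ be a complex Hilbert space, let $A\in\mathcal{B}(H)$ be positive, and let $T:\mathcal{D}(T)\subseteq H\to H$ be a densely defined closable linear operator satisfying $\mathcal{R}(T^*A)\subseteq\mathcal{R}(A)$. Then: (1) $T^{\#}$ is a closed operator. (2) $T^{\#}$ is an $A$-closed operator. (3) If $(T^{\#})^{\#}$ exists, then $P_A\overline{T}\subseteq(T^{\#})^{\#}$; equivalently, $A\overline{T}\subseteq A(T^{\#})^{\#}=(T^{\#})^*A$. If, in addition, $(T^*A)^*=A\overline{T}$, then $(T^{\#})^{\#}$ exists and $(T^{\#})^{\#}=P_A\overline{T}$. In particular, $A(T^{\#})^{\#}=A\overline{T}$.
   Context: Inner products are linear in the first variable. For a positive bounded operator $A$ on $H$, $\langle f,g\rangle_A=\langle Af,g\rangle$ and $\|f\|_A=\langle Af,f\rangle^{1/2}$. $\mathcal{D}(\cdot)$, $\mathcal{R}(\cdot)$, $\mathcal{N}(\cdot)$ denote domain, range and null space; $T^*$ is the Hilbert-space adjoint, $\overline{T}$ the closure of $T$, and $P_A$ the orthogonal projection of $H$ onto $\overline{\mathcal{R}(A)}$. Products of operators have their natural domains, and $S\subseteq T$ means that $T$ extends $S$. $A$-adjoint: let $T:\mathcal{D}(T)\subseteq H\to H$ be densely defined and closable with $\mathcal{R}(T^*A)\subseteq\mathcal{R}(A)$ (in this case one says $T^{\#}$ exists). The $A$-adjoint $T^{\#}$ has domain the set of $f\in H$ for which there is a unique $g_f\in\overline{\mathcal{R}(A)}$ with $\langle Th,f\rangle_A=\langle h,g_f\rangle_A$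 for every $h\in\mathcal{D}(T)$, and $T^{\#}f=g_f$. It is the unique operator with $AT^{\#}=T^*A$ (equality including domains) and $\mathcal{R}(T^{\#})\subseteq\overline{\mathcal{R}(A)}$. $(T^{\#})^{\#}$ is the $A$-adjoint of $T^{\#}$. A linear operator $T:\mathcal{D}(T)\subseteq H\to H$ is $A$-closed if, whenever $\{f_k\}_{k\in\mathbb{N}}\subseteq\mathcal{D}(T)\cap\overline{\mathcal{R}(A)}$ satisfies $\|f_k-f\|_A\to0$ and $\|Tf_k-g\|_A\to0$ for some $f,g\in H$, one has $f\in\mathcal{D}(T)$ and $Tf-g\in\mathcal{N}(A)$. *)

theory Defs
  imports "HOL-Analysis.Analysis"
begin

section \<open>Complex Hilbert spaces\<close>

class complex_inner = real_normed_vector +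
  fixes scaleC :: "complex \<Rightarrow> 'a \<Rightarrow> 'a"  (infixr \<open>*\<^sub>C\<close> 75)
    and cinner :: "'a \<Rightarrow> 'a \<Rightarrow> complex"
  assumes scaleC_add_right: "c *\<^sub>C (x + y) = c *\<^sub>C x + c *\<^sub>C y"
    and scaleC_add_left: "(c + d) *\<^sub>C x = c *\<^sub>C x + d *\<^sub>C x"
    and scaleC_scaleC: "c *\<^sub>C d *\<^sub>C x = (c * d) *\<^sub>C x"
    and scaleC_of_real: "of_real r *\<^sub>C x = r *\<^sub>R x"
    and cinner_commute: "cinner x y = cnj (cinner y x)"
    and cinner_add_left: "cinner (x + y) z = cinner x z + cinner y z"
    and cinner_scaleC_left: "cinner (c *\<^sub>C x) y = c * cinner x y"
    and cinner_ge_zero: "0 \<le> Re (cinner x x)"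
    and cinner_eq_zero_iff: "cinner x x = 0 \<longleftrightarrow> x = 0"
    and norm_eq_sqrt_cinner: "norm x = sqrt (Re (cinner x x))"

class chilbert_space = complex_inner + complete_space

global_interpretation complex_vector:
  vector_space "scaleC :: complex \<Rightarrow> 'a \<Rightarrow> 'a::complex_inner"
proof
  show "1 *\<^sub>C x = x" for x :: 'a
    using scaleC_of_real[of 1 x] by simp
qed (simp_all add: scaleC_add_right scaleC_add_left scaleC_scaleC)

instantiation complex :: chilbert_space
begin
definition scaleC_complex :: "complex \<Rightarrow> complex \<Rightarrow> complex"
  where "scaleC_complex c x = c * x"
definition cinner_complex :: "complex \<Rightarrow> complex \<Rightarrow> complex"
  where "cinner_complex x y = x * cnj y"
instance
proof
  show "norm x = sqrt (Re (cinner x x))" for x :: complex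
    by (simp add: cinner_complex_def cmod_def power2_eq_square)
  show "0 \<le> Re (cinner x x)" for x :: complex
    by (simp add: cinner_complex_def)
  show "of_real r *\<^sub>C x = r *\<^sub>R x" for r and x :: complex
    by (simp add: scaleC_complex_def scaleR_conv_of_real)
qed (simp_all add: scaleC_complex_def cinner_complex_def distrib_left distrib_right mult.assoc mult.commute)
end


section \<open>Bounded operators\<close>

definition bounded_clinear :: "('h::complex_inner \<Rightarrow> 'h) \<Rightarrow> bool"
  where "bounded_clinear A \<longleftrightarrow> Vector_Spaces.linear (*\<^sub>C) (*\<^sub>C) A \<and> bounded_linear A"

text \<open>Membership in \<open>\<real>\<^sub>\<ge>\<^sub>0\<close> says that the complex number is real and nonnegative.\<close>

definition positive_op :: "('h::complex_inner \<Rightarrow> 'h) \<Rightarrow> bool"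
  where "positive_op A \<longleftrightarrow> (\<forall>f. cinner (A f) f \<in> \<real>\<^sub>\<ge>\<^sub>0)"

definition cinner_A :: "('h::complex_inner \<Rightarrow> 'h) \<Rightarrow> 'h \<Rightarrow> 'h \<Rightarrow> complex"
  where "cinner_A A f g = cinner (A f) g"

definition norm_A :: "('h::complex_inner \<Rightarrow> 'h) \<Rightarrow> 'h \<Rightarrow> real"
  where "norm_A A f = sqrt (Re (cinner (A f) f))"

definition orth_proj :: "'h::complex_inner set \<Rightarrow> 'h \<Rightarrow> 'h"
  where "orth_proj M f = (THE g. g \<in> M \<and> (\<forall>m\<in>M. cinner (f - g) m = 0))"

abbreviation P_A :: "('h::complex_inner \<Rightarrow> 'h) \<Rightarrow> 'h \<Rightarrow> 'h"
  where "P_A A \<equiv> orth_proj (closure (range A))"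


section \<open>Partially defined operators\<close>

text \<open>
  An operator \<open>T : D(T) \<subseteq> H \<rightarrow> H\<close> is a partial function \<open>T :: 'h \<rightharpoonup> 'h\<close> with
  \<open>D(T) = dom T\<close> and \<open>R(T) = ran T\<close>. Thus \<open>\<circ>\<^sub>m\<close> is the product with its natural domain,
  \<open>S \<subseteq>\<^sub>m T\<close> says that \<open>T\<close> extends \<open>S\<close>, and \<open>S = T\<close> includes equality of the domains.
\<close>

abbreviation tot :: "('h \<Rightarrow> 'h) \<Rightarrow> 'h \<rightharpoonup> 'h"
  where "tot B \<equiv> Some \<circ> B"

definition op_of_graph :: "('h \<times> 'h) set \<Rightarrow> 'h \<rightharpoonup> 'h"
  where "op_of_graph G f = (if \<exists>!g. (f, g) \<in> G then Some (THE g. (f, g) \<in> G) else None)"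

definition linear_op :: "('h::complex_inner \<rightharpoonup> 'h) \<Rightarrow> bool"
  where "linear_op T \<longleftrightarrow>
    complex_vector.subspace (dom T) \<and>
    (\<forall>f\<in>dom T. \<forall>g\<in>dom T. the (T (f + g)) = the (T f) + the (T g)) \<and>
    (\<forall>c. \<forall>f\<in>dom T. the (T (c *\<^sub>C f)) = c *\<^sub>C the (T f))"

definition densely_defined :: "('h::complex_inner \<rightharpoonup> 'h) \<Rightarrow> bool"
  where "densely_defined T \<longleftrightarrow> closure (dom T) = UNIV"

definition closed_op :: "('h::complex_inner \<rightharpoonup> 'h) \<Rightarrow> bool"
  where "closed_op T \<longleftrightarrow> linear_op T \<and> closed (Map.graph T)"

text \<open>\<open>T\<close> is closable if the closure of its graph is again the graph of a function.\<close>

definition closable_op :: "('h::complex_inner \<rightharpoonup> 'h) \<Rightarrow> bool"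
  where "closable_op T \<longleftrightarrow> single_valued (closure (Map.graph T))"

definition op_closure :: "('h::complex_inner \<rightharpoonup> 'h) \<Rightarrow> 'h \<rightharpoonup> 'h"
  where "op_closure T = op_of_graph (closure (Map.graph T))"

text \<open>
  The uniqueness demanded by \<^const>\<open>op_of_graph\<close> is automatic for densely defined \<open>T\<close>.
  If \<open>T\<close> is not densely defined, then \<open>adj T\<close> is the nowhere defined function, which is
  not a linear operator; so an equation \<open>adj T = S\<close> with a linear operator \<open>S\<close> carries
  with it that \<open>T\<close> is densely defined.
\<close>

definition adj :: "('h::complex_inner \<rightharpoonup> 'h) \<Rightarrow> 'h \<rightharpoonup> 'h"
  where "adj T = op_of_graph {(f, g). \<forall>h\<in>dom T. cinner (the (T h)) f = cinner h g}"


section \<open>The A-adjoint and A-closed operators\<close>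

definition A_adj_exists :: "('h::complex_inner \<Rightarrow> 'h) \<Rightarrow> ('h \<rightharpoonup> 'h) \<Rightarrow> bool"
  where "A_adj_exists A T \<longleftrightarrow>
    linear_op T \<and> densely_defined T \<and> closable_op T \<and> ran (adj T \<circ>\<^sub>m tot A) \<subseteq> range A"

definition A_adj :: "('h::complex_inner \<Rightarrow> 'h) \<Rightarrow> ('h \<rightharpoonup> 'h) \<Rightarrow> 'h \<rightharpoonup> 'h"
  where "A_adj A T = op_of_graph {(f, g). g \<in> closure (range A) \<and>
    (\<forall>h\<in>dom T. cinner_A A (the (T h)) f = cinner_A A h g)}"

definition A_closed :: "('h::complex_inner \<Rightarrow> 'h) \<Rightarrow> ('h \<rightharpoonup> 'h) \<Rightarrow> bool"
  where "A_closed A T \<longleftrightarrow> linear_op T \<and>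
    (\<forall>u f g. range u \<subseteq> dom T \<inter> closure (range A) \<longrightarrow>
      (\<lambda>k::nat. norm_A A (u k - f)) \<longlonglongrightarrow> 0 \<longrightarrow>
      (\<lambda>k. norm_A A (the (T (u k)) - g)) \<longlonglongrightarrow> 0 \<longrightarrow>
      f \<in> dom T \<and> A (the (T f) - g) = 0)"

end

theory Submission
  imports Defs
begin

text \<open>
  Write \<open>M\<close> for the closure of the range of \<open>A\<close>. Since \<open>A\<close> is self-adjoint and injective on \<open>M\<close>,
  \<open>T\<^sup># f = g\<close> means that \<open>g \<in> M\<close> and \<open>T\<^sup>* (A f) = A g\<close>; this is a closed condition on \<open>(f, g)\<close>, and it
  depends only on \<open>A f\<close> and \<open>A g\<close>, which are continuous with respect to the \<open>A\<close>-seminorm.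
  Passing to the closure of \<open>T\<close> in the defining relation of \<open>T\<^sup>*\<close> gives the inclusion (3).
  For the last part, \<open>(A S)\<^sup>* = S\<^sup>* A\<close> holds for every \<open>S\<close>; with \<open>S = T\<^sup>#\<close> and \<open>A T\<^sup># = T\<^sup>* A\<close> it turns
  the hypothesis into a description of \<open>(T\<^sup>#)\<^sup>* A\<close>, from which both the density of the
  domain of \<open>T\<^sup>#\<close> and the range condition can be read off.
\<close>

section \<open>Positive sesquilinear forms\<close>

context complex_inner
begin

lemma cinner_add_right: "cinner x (y + z) = cinner x y + cinner x z"
  by (metis cinner_add_left cinner_commute complex_cnj_add)

lemma cinner_scaleC_right: "cinner x (c *\<^sub>C y) = cnj c * cinner x y"
  by (metis cinner_scaleC_left cinner_commute complex_cnj_mult)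

lemma norm_power2_eq_cinner: "(norm x)\<^sup>2 = Re (cinner x x)"
  by (simp add: norm_eq_sqrt_cinner cinner_ge_zero)

end

lemma cinner_self_nonneg_Reals: "cinner (x::'h::complex_inner) x \<in> \<real>\<^sub>\<ge>\<^sub>0"
proof -
  have "Im (cinner x x) = 0"
    using arg_cong[OF cinner_commute[of x x], of Im] by simp
  then show ?thesis
    by (simp add: complex_nonneg_Reals_iff cinner_ge_zero)
qed

text \<open>Polarisation: reality of the form at \<open>x + y\<close> fixes the imaginary parts of
  the two mixed terms, reality at \<open>x + \<i> *\<^sub>C y\<close> the real parts.\<close>

lemma positive_form_hermitian:
  fixes B :: "'h::complex_inner \<Rightarrow> 'h"
  assumes add: "\<And>x y. B (x + y) = B x + B y" and scale: "\<And>c x. B (c *\<^sub>C x) = c *\<^sub>C B x"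
    and pos: "positive_op B"
  shows "cinner (B x) y = cinner x (B y)"
proof -
  have real: "Im (cinner (B z) z) = 0" for z
    using pos by (auto simp: positive_op_def complex_nonneg_Reals_iff)
  have "Im (cinner (B x) y + cinner (B y) x) = 0"
    using real[of "x + y"] real[of x] real[of y]
    by (simp add: add cinner_add_left cinner_add_right)
  moreover have "Re (cinner (B x) y) = Re (cinner (B y) x)"
    using real[of "x + \<i> *\<^sub>C y"] real[of x] real[of y]
    by (simp add: add scale cinner_add_left cinner_add_right cinner_scaleC_left cinner_scaleC_right)
  ultimately have "cinner (B x) y = cnj (cinner (B y) x)"
    by (simp add: complex_eq_iff)
  then show ?thesis
    by (metis cinner_commute)
qed

text \<open>One discriminant argument serves both the ordinary inner product (\<open>B\<close> the
  identity) and the semi-inner product induced by \<open>A\<close>.\<close>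

lemma positive_form_Cauchy_Schwarz:
  fixes B :: "'h::complex_inner \<Rightarrow> 'h"
  assumes add: "\<And>x y. B (x + y) = B x + B y" and scale: "\<And>c x. B (c *\<^sub>C x) = c *\<^sub>C B x"
    and pos: "positive_op B"
  shows "(cmod (cinner (B x) y))\<^sup>2 \<le> Re (cinner (B x) x) * Re (cinner (B y) y)"
proof -
  define q where "q = cinner (B x) y"
  define a where "a = Re (cinner (B x) x)"
  define b where "b = Re (cinner (B y) y)"
  define s where "s = (cmod q)\<^sup>2"
  have nonneg: "Re (cinner (B z) z) \<ge> 0" for z
    using pos by (auto simp: positive_op_def complex_nonneg_Reals_iff)
  have q': "cinner (B y) x = cnj q"
    unfolding q_def by (metis cinner_commute positive_form_hermitian[OF assms])
  have quad: "0 \<le> a - 2 * t * s + t\<^sup>2 * s * b" for t :: real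
  proof -
    \<comment> \<open>Along this multiple of \<open>y\<close> both cross terms equal
      \<open>- t * s\<close>, so positivity becomes a real quadratic inequality in
      \<open>t\<close>.\<close>
    define c where "c = - of_real t * q"
    have "cinner (B (x + c *\<^sub>C y)) (x + c *\<^sub>C y)
        = cinner (B x) x + cnj c * q + c * cnj q + c * cnj c * cinner (B y) y"
      by (simp add: add scale cinner_add_left cinner_add_right cinner_scaleC_left
          cinner_scaleC_right q' algebra_simps flip: q_def)
    moreover have "Im (cinner (B y) y) = 0"
      using pos by (auto simp: positive_op_def complex_nonneg_Reals_iff)
    ultimately have "Re (cinner (B (x + c *\<^sub>C y)) (x + c *\<^sub>C y))
        = a + Re (cnj c * q + c * cnj q) + Re (c * cnj c) * b"
      by (simp add: a_def b_def)
    also have "\<dots> = a - 2 * t * s + t\<^sup>2 * s * b"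
      unfolding c_def s_def cmod_power2 by (simp add: algebra_simps power2_eq_square)
    finally show ?thesis
      using nonneg by metis
  qed
  have "a \<ge> 0" "b \<ge> 0" "s \<ge> 0"
    by (auto simp: a_def b_def s_def nonneg)
  have "s \<le> a * b"
  proof (cases "b = 0")
    case True
    have "s = 0"
    proof (rule ccontr)
      assume "s \<noteq> 0"
      \<comment> \<open>With \<open>b = 0\<close> the quadratic is affine in \<open>t\<close>; the
        chosen \<open>t\<close> gives it the value -1.\<close>
      then show False
        using quad[of "(a + 1) / (2 * s)"] True \<open>a \<ge> 0\<close> by simp
    qed
    then show ?thesis
      using True by simp
  next
    case False
    \<comment> \<open>The choice \<open>t = 1 / b\<close> minimises the quadratic and leaves
      \<open>0 \<le> a - s / b\<close>.\<close>
    then show ?thesis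
      using quad[of "1 / b"] \<open>b \<ge> 0\<close> by (simp add: power2_eq_square field_simps)
  qed
  then show ?thesis
    by (simp add: s_def a_def b_def q_def)
qed

lemma norm_cinner_le: "cmod (cinner x y) \<le> norm x * norm (y::'h::complex_inner)"
proof -
  have "(cmod (cinner x y))\<^sup>2 \<le> (norm x * norm y)\<^sup>2"
    using positive_form_Cauchy_Schwarz[of "\<lambda>x::'h. x" x y, OF refl refl]
    by (simp add: positive_op_def cinner_self_nonneg_Reals power_mult_distrib norm_power2_eq_cinner[of x] norm_power2_eq_cinner[of y])
  then show ?thesis
    by (rule power2_le_imp_le) simp
qed

interpretation cinner: bounded_bilinear "cinner :: 'h::complex_inner \<Rightarrow> 'h \<Rightarrow> complex"
proof
  show "cinner (r *\<^sub>R a) b = r *\<^sub>R cinner a b" for r and a b :: 'h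
    by (metis cinner_scaleC_left scaleC_of_real scaleR_conv_of_real)
  show "cinner a (r *\<^sub>R b) = r *\<^sub>R cinner a b" for r and a b :: 'h
    by (metis cinner_scaleC_right complex_cnj_complex_of_real scaleC_of_real scaleR_conv_of_real)
  show "\<exists>K. \<forall>a b :: 'h. cmod (cinner a b) \<le> norm a * norm b * K"
    by (rule exI[of _ 1]) (simp add: norm_cinner_le)
qed (simp_all add: cinner_add_left cinner_add_right)


section \<open>Orthogonal projections\<close>

lemma parallelogram_law:
  "(norm (x + y))\<^sup>2 + (norm (x - y))\<^sup>2 = 2 * (norm x)\<^sup>2 + 2 * (norm (y::'h::complex_inner))\<^sup>2"
  by (simp add: norm_power2_eq_cinner cinner.add_left cinner.add_right cinner.diff_left
      cinner.diff_right)

text \<open>If \<open>q = cinner e m\<close> were nonzero, subtracting a small multiple of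
  \<open>q *\<^sub>C m\<close> would shorten \<open>e\<close>: the squared norm drops by
  \<open>t * (cmod q)\<^sup>2 * (2 - t * (norm m)\<^sup>2)\<close>.\<close>

lemma minimal_distance_orthogonal:
  fixes e m :: "'h::complex_inner"
  assumes "\<And>c. norm e \<le> norm (e - c *\<^sub>C m)"
  shows "cinner e m = 0"
proof -
  define q where "q = cinner e m"
  \<comment> \<open>The summand 1 keeps \<open>t\<close> positive and
    \<open>t * (norm m)\<^sup>2\<close> below 1, also when \<open>m = 0\<close>.\<close>
  define t where "t = 1 / ((norm m)\<^sup>2 + 1)"
  define c where "c = of_real t * q"
  have q': "cinner m e = cnj q"
    unfolding q_def by (rule cinner_commute)
  have "(norm m)\<^sup>2 + 1 > 0"
    by (simp add: add_nonneg_pos)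
  then have t: "t > 0" "t * (norm m)\<^sup>2 < 1"
    by (auto simp: t_def)
  have "Im (cinner m m) = 0"
    using cinner_self_nonneg_Reals[of m] by (auto simp: complex_nonneg_Reals_iff)
  moreover have "cinner (e - c *\<^sub>C m) (e - c *\<^sub>C m)
      = cinner e e - cnj c * q - c * cnj q + c * cnj c * cinner m m"
    by (simp add: cinner.diff_left cinner.diff_right cinner_scaleC_left cinner_scaleC_right q'
        algebra_simps flip: q_def)
  ultimately have "(norm (e - c *\<^sub>C m))\<^sup>2
      = (norm e)\<^sup>2 - Re (cnj c * q + c * cnj q) + Re (c * cnj c) * (norm m)\<^sup>2"
    by (simp add: norm_power2_eq_cinner)
  also have "\<dots> = (norm e)\<^sup>2 - t * (cmod q)\<^sup>2 * (2 - t * (norm m)\<^sup>2)"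
    unfolding c_def cmod_power2 by (simp add: algebra_simps power2_eq_square)
  finally have "(norm (e - c *\<^sub>C m))\<^sup>2 = \<dots>" .
  moreover have "(norm e)\<^sup>2 \<le> (norm (e - c *\<^sub>C m))\<^sup>2"
    using assms by (simp add: power_mono)
  ultimately have "t * (cmod q)\<^sup>2 * (2 - t * (norm m)\<^sup>2) \<le> 0"
    by simp
  then have "t * (cmod q)\<^sup>2 \<le> 0"
    using t by (simp add: mult_le_0_iff)
  then have "q = 0"
    using t by (simp add: mult_le_0_iff)
  then show ?thesis
    by (simp add: q_def)
qed

text \<open>A minimising sequence is Cauchy by the parallelogram law, and its limit attains the
  distance.\<close>

lemma nearest_point_exists:
  fixes M :: "'h::chilbert_space set"
  assumes "convex M" "closed M" "M \<noteq> {}"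
  shows "\<exists>g\<in>M. \<forall>m\<in>M. norm (f - g) \<le> norm (f - m)"
proof -
  define d where "d = infdist f M"
  have d_le: "d \<le> norm (f - m)" if "m \<in> M" for m
    unfolding d_def using infdist_le[OF that, of f] by (simp add: dist_norm)
  have d0: "d \<ge> 0"
    by (simp add: d_def infdist_nonneg)
  have "\<exists>m\<in>M. norm (f - m) < d + inverse (Suc n)" for n
  proof (rule ccontr)
    assume "\<not> ?thesis"
    then have "d + inverse (Suc n) \<le> infdist f M"
      unfolding infdist_notempty[OF assms(3)] using assms(3)
      by (intro cINF_greatest) (auto simp: dist_norm not_less)
    then show False
      using inverse_Suc[of n, where 'a=real] by (simp add: d_def)
  qed
  then obtain u where uM: "\<And>n. u n \<in> M" and u: "\<And>n. norm (f - u n) < d + inverse (Suc n)"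
    by metis
  have lim: "(\<lambda>n. norm (f - u n)) \<longlonglongrightarrow> d"
  proof (rule tendsto_sandwich)
    show "\<forall>\<^sub>F n in sequentially. d \<le> norm (f - u n)"
      by (simp add: d_le uM)
    show "\<forall>\<^sub>F n in sequentially. norm (f - u n) \<le> d + inverse (Suc n)"
      using u by (intro always_eventually allI less_imp_le)
  qed (use LIMSEQ_inverse_real_of_nat_add in auto)
  \<comment> \<open>The midpoint of \<open>u i\<close> and \<open>u j\<close> lies in
    \<open>M\<close> by convexity, so the sum of the two error vectors has norm at least
    \<open>2 * d\<close>; the parallelogram law then bounds their difference.\<close>
  have gap: "(norm (u i - u j))\<^sup>2
      \<le> 2 * ((norm (f - u i))\<^sup>2 - d\<^sup>2) + 2 * ((norm (f - u j))\<^sup>2 - d\<^sup>2)" for i j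
  proof -
    have "(1/2) *\<^sub>R u i + (1/2) *\<^sub>R u j \<in> M"
      using assms(1) uM by (simp add: convex_def)
    then have "2 * d \<le> 2 * norm (f - ((1/2) *\<^sub>R u i + (1/2) *\<^sub>R u j))"
      using d_le by simp
    also have "\<dots> = norm (2 *\<^sub>R (f - ((1/2) *\<^sub>R u i + (1/2) *\<^sub>R u j)))"
      by simp
    also have "2 *\<^sub>R (f - ((1/2) *\<^sub>R u i + (1/2) *\<^sub>R u j)) = (f - u i) + (f - u j)"
      by (simp add: algebra_simps scaleR_2)
    finally have "(2 * d)\<^sup>2 \<le> (norm ((f - u i) + (f - u j)))\<^sup>2"
      using d0 by (intro power_mono) auto
    then show ?thesis
      using parallelogram_law[of "f - u i" "f - u j"]
      by (simp add: norm_minus_commute power_mult_distrib)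
  qed
  have "Cauchy u"
  proof (rule metric_CauchyI)
    fix r :: real assume "r > 0"
    have "(\<lambda>n. (norm (f - u n))\<^sup>2 - d\<^sup>2) \<longlonglongrightarrow> d\<^sup>2 - d\<^sup>2"
      by (intro tendsto_intros lim)
    \<comment> \<open>In \<open>gap\<close> two such terms enter with factor 2 each, so their total
      stays below \<open>r\<^sup>2\<close>.\<close>
    then have "\<forall>\<^sub>F n in sequentially. (norm (f - u n))\<^sup>2 - d\<^sup>2 < r\<^sup>2 / 4"
      using \<open>r > 0\<close> by (intro order_tendstoD) auto
    then obtain N where N: "\<And>n. n \<ge> N \<Longrightarrow> (norm (f - u n))\<^sup>2 - d\<^sup>2 < r\<^sup>2 / 4"
      by (auto simp: eventually_sequentially)
    have "dist (u i) (u j) < r" if "i \<ge> N" "j \<ge> N" for i j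
    proof -
      have "(norm (u i - u j))\<^sup>2 < r\<^sup>2"
        using gap[of i j] N[OF that(1)] N[OF that(2)] by argo
      then show ?thesis
        using \<open>r > 0\<close> by (simp add: dist_norm power_less_imp_less_base)
    qed
    then show "\<exists>N. \<forall>i\<ge>N. \<forall>j\<ge>N. dist (u i) (u j) < r"
      by blast
  qed
  then obtain g where g: "u \<longlonglongrightarrow> g"
    using Cauchy_convergent convergent_def by blast
  then have "g \<in> M"
    using assms(2) uM closed_sequentially by blast
  moreover have "norm (f - g) = d"
    by (rule LIMSEQ_unique[OF _ lim]) (intro tendsto_intros g)
  ultimately show ?thesis
    using d_le by metis
qed

text \<open>A nearest point has orthogonal error, since moving it inside \<open>M\<close> cannot
  shorten the error. The difference of two candidates lies in \<open>M\<close> and is orthogonal to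
  itself, so \<open>THE\<close> in \<open>orth_proj\<close> is meaningful.\<close>

lemma closed_subspace_projection:
  fixes M :: "'h::chilbert_space set"
  assumes sub: "complex_vector.subspace M" and "closed M"
  shows "\<exists>!g. g \<in> M \<and> (\<forall>m\<in>M. cinner (f - g) m = 0)"
proof -
  have scaleR: "r *\<^sub>R x \<in> M" if "x \<in> M" for r x
    using complex_vector.subspace_scale[OF sub that, of "of_real r"] by (simp add: scaleC_of_real)
  have "convex M"
    unfolding convex_def using scaleR complex_vector.subspace_add[OF sub] by blast
  moreover have "M \<noteq> {}"
    using complex_vector.subspace_0[OF sub] by blast
  ultimately obtain g where g: "g \<in> M" "\<And>m. m \<in> M \<Longrightarrow> norm (f - g) \<le> norm (f - m)"
    using nearest_point_exists[OF _ \<open>closed M\<close>] by blast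
  have orth: "cinner (f - g) m = 0" if "m \<in> M" for m
  proof (rule minimal_distance_orthogonal)
    fix c
    have "g + c *\<^sub>C m \<in> M"
      by (intro complex_vector.subspace_add[OF sub] complex_vector.subspace_scale[OF sub] g that)
    then show "norm (f - g) \<le> norm (f - g - c *\<^sub>C m)"
      using g(2) by (simp add: algebra_simps)
  qed
  have "g' = g" if g': "g' \<in> M" "\<forall>m\<in>M. cinner (f - g') m = 0" for g'
  proof -
    have "g' - g \<in> M"
      by (rule complex_vector.subspace_diff[OF sub g'(1) g(1)])
    then have "cinner ((f - g) - (f - g')) (g' - g) = 0"
      using orth g'(2) by (subst cinner.diff_left) simp
    then show ?thesis
      by (simp add: cinner_eq_zero_iff)
  qed
  then show ?thesis
    using g(1) orth by blast
qed

lemma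
  fixes M :: "'h::chilbert_space set"
  assumes "complex_vector.subspace M" and "closed M"
  shows orth_proj_in: "orth_proj M f \<in> M"
    and orth_proj_orthogonal: "m \<in> M \<Longrightarrow> cinner (f - orth_proj M f) m = 0"
  using theI'[OF closed_subspace_projection[OF assms, of f]] unfolding orth_proj_def by blast+

lemma subspace_closure_complex:
  fixes M :: "'h::complex_inner set"
  assumes sub: "complex_vector.subspace M"
  shows "complex_vector.subspace (closure M)"
proof (rule complex_vector.subspaceI)
  show "0 \<in> closure M"
    using complex_vector.subspace_0[OF sub] closure_subset by blast
next
  fix x y assume "x \<in> closure M" "y \<in> closure M"
  then obtain u v where "\<And>n. u n \<in> M" "u \<longlonglongrightarrow> x" "\<And>n. v n \<in> M" "v \<longlonglongrightarrow> y"
    unfolding closure_sequential by blast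
  then have "\<And>n. u n + v n \<in> M" "(\<lambda>n. u n + v n) \<longlonglongrightarrow> x + y"
    by (auto intro: tendsto_add complex_vector.subspace_add[OF sub])
  then show "x + y \<in> closure M"
    unfolding closure_sequential by (intro exI[of _ "\<lambda>n. u n + v n"]) simp
next
  fix c x assume "x \<in> closure M"
  then obtain u where u: "\<And>n. u n \<in> M" "u \<longlonglongrightarrow> x"
    unfolding closure_sequential by blast
  \<comment> \<open>Homogeneity of the norm under complex scalars is what makes complex scaling
    continuous.\<close>
  have norm_scaleC: "norm (c *\<^sub>C z) = cmod c * norm z" for z :: 'h
  proof -
    have "cinner (c *\<^sub>C z) (c *\<^sub>C z) = of_real ((cmod c)\<^sup>2) * cinner z z"
      unfolding complex_norm_square by (simp add: cinner_scaleC_left cinner_scaleC_right)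
    then have "(norm (c *\<^sub>C z))\<^sup>2 = (cmod c * norm z)\<^sup>2"
      by (simp add: norm_power2_eq_cinner[where 'a='h] power_mult_distrib del: of_real_power)
    then show ?thesis
      by (simp add: power2_eq_iff_nonneg)
  qed
  have "(\<lambda>n. cmod c * norm (u n - x)) \<longlonglongrightarrow> cmod c * 0"
    by (intro tendsto_mult tendsto_const tendsto_norm_zero Lim_null[THEN iffD1] u)
  then have "(\<lambda>n. norm (c *\<^sub>C u n - c *\<^sub>C x)) \<longlonglongrightarrow> 0"
    by (simp add: norm_scaleC flip: complex_vector.scale_right_diff_distrib)
  then have "(\<lambda>n. c *\<^sub>C u n) \<longlonglongrightarrow> c *\<^sub>C x"
    using Lim_null tendsto_norm_zero_iff by blast
  moreover have "\<And>n. c *\<^sub>C u n \<in> M"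
    using u complex_vector.subspace_scale[OF sub] by blast
  ultimately show "c *\<^sub>C x \<in> closure M"
    unfolding closure_sequential by (intro exI[of _ "\<lambda>n. c *\<^sub>C u n"]) simp
qed

text \<open>Orthogonality to \<open>z\<close> is a closed condition, so it spreads from
  \<open>D\<close> to the whole space and in particular to \<open>z\<close> itself.\<close>

lemma orthogonal_dense_eq_0:
  fixes z :: "'h::complex_inner"
  assumes "closure D = UNIV" and "\<And>h. h \<in> D \<Longrightarrow> cinner h z = 0"
  shows "z = 0"
proof -
  have "closed {h. cinner h z = 0}"
    by (intro closed_Collect_eq continuous_intros cinner.continuous_on)
  then have "closure D \<subseteq> {h. cinner h z = 0}"
    using assms(2) by (intro closure_minimal) auto
  then show ?thesis
    using assms(1) cinner_eq_zero_iff by blast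
qed


section \<open>Partially defined operators\<close>

lemma map_eqI:
  assumes "\<And>x y. S x = Some y \<longleftrightarrow> T x = Some y"
  shows "S = T"
  using assms by (intro ext) (metis option.exhaust)

lemma map_comp_tot [simp]: "(S \<circ>\<^sub>m tot B) f = S (B f)"
  by (simp add: map_comp_def)

lemma tot_map_comp_Some: "(tot B \<circ>\<^sub>m S) f = Some k \<longleftrightarrow> (\<exists>g. S f = Some g \<and> k = B g)"
  by (auto simp: map_comp_Some_iff)

lemma op_of_graph_SomeD: "op_of_graph G f = Some g \<Longrightarrow> (f, g) \<in> G"
  by (auto simp: op_of_graph_def split: if_splits intro: theI')

lemma op_of_graph_Some_iff:
  assumes "single_valued G"
  shows "op_of_graph G f = Some g \<longleftrightarrow> (f, g) \<in> G"
proof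
  assume "(f, g) \<in> G"
  moreover from this have "g' = g" if "(f, g') \<in> G" for g'
    using assms that by (auto dest: single_valuedD)
  ultimately have "\<exists>!g. (f, g) \<in> G" "(THE g. (f, g) \<in> G) = g"
    by blast+
  then show "op_of_graph G f = Some g"
    by (simp add: op_of_graph_def)
qed (rule op_of_graph_SomeD)

lemma linear_opI:
  assumes "S 0 = Some 0"
    and "\<And>f g f' g'. S f = Some g \<Longrightarrow> S f' = Some g' \<Longrightarrow> S (f + f') = Some (g + g')"
    and "\<And>c f g. S f = Some g \<Longrightarrow> S (c *\<^sub>C f) = Some (c *\<^sub>C g)"
  shows "linear_op S"
  unfolding linear_op_def
proof (intro conjI ballI allI)
  show "complex_vector.subspace (dom S)"
    using assms by (intro complex_vector.subspaceI) (auto simp: dom_def)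
qed (auto simp: dom_def assms(2,3))

text \<open>Two candidate values differ by a vector orthogonal to the dense set
  \<open>dom T\<close>, so the uniqueness test built into \<open>op_of_graph\<close> always
  succeeds.\<close>

lemma adj_Some_iff:
  assumes "densely_defined T"
  shows "adj T f = Some g \<longleftrightarrow> (\<forall>h\<in>dom T. cinner (the (T h)) f = cinner h g)"
proof -
  have "single_valued {(f, g). \<forall>h\<in>dom T. cinner (the (T h)) f = cinner h g}"
  proof (rule single_valuedI, clarify)
    fix f g g'
    assume "\<forall>h\<in>dom T. cinner (the (T h)) f = cinner h g"
      and "\<forall>h\<in>dom T. cinner (the (T h)) f = cinner h g'"
    then have "g - g' = 0"
      using assms by (intro orthogonal_dense_eq_0[of "dom T"])
        (auto simp: densely_defined_def cinner.diff_right)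
    then show "g = g'"
      by simp
  qed
  then show ?thesis
    by (simp add: adj_def op_of_graph_Some_iff)
qed

lemma op_closure_Some_iff:
  "closable_op T \<Longrightarrow> op_closure T f = Some g \<longleftrightarrow> (f, g) \<in> closure (Map.graph T)"
  by (simp add: op_closure_def closable_op_def op_of_graph_Some_iff)

text \<open>For fixed \<open>f\<close> and \<open>g\<close> the adjoint relation is a closed
  condition on pairs, so it passes from the graph of \<open>T\<close> to its closure.\<close>

lemma adj_op_closure:
  assumes "densely_defined T" "closable_op T"
    and "op_closure T x = Some y" and "adj T f = Some g"
  shows "cinner y f = cinner x g"
proof -
  have "closed {p. cinner (snd p) f = cinner (fst p) g}"
    by (intro closed_Collect_eq continuous_intros cinner.continuous_on)
  moreover have "Map.graph T \<subseteq> {p. cinner (snd p) f = cinner (fst p) g}"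
    using assms(4) by (force simp: adj_Some_iff[OF assms(1)] dest: in_graphD)
  ultimately have "closure (Map.graph T) \<subseteq> {p. cinner (snd p) f = cinner (fst p) g}"
    by (rule closure_minimal[rotated])
  then show ?thesis
    using assms(3) by (auto simp: op_closure_Some_iff[OF assms(2)])
qed

text \<open>The adjoint of \<open>T\<close> is somewhere defined only if its values are unique, which rules out
  a nonzero vector orthogonal to the domain of \<open>T\<close>.\<close>

lemma densely_defined_if_adj_defined:
  fixes T :: "'h::chilbert_space \<rightharpoonup> 'h"
  assumes sub: "complex_vector.subspace (dom T)" and "adj T f = Some g"
  shows "densely_defined T"
proof -
  let ?M = "closure (dom T)"
  have M: "complex_vector.subspace ?M" "closed ?M"
    by (auto intro: subspace_closure_complex sub)
  have ex1: "\<exists>!g. \<forall>h\<in>dom T. cinner (the (T h)) f = cinner h g"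
    using assms(2) by (auto simp: adj_def op_of_graph_def split: if_splits)
  have "x \<in> ?M" for x
  proof -
    \<comment> \<open>The component of \<open>x\<close> orthogonal to \<open>?M\<close> can be added
      to \<open>g\<close> without disturbing the adjoint relation; uniqueness of the value forces it
      to vanish.\<close>
    define z where "z = x - orth_proj ?M x"
    have "cinner h z = 0" if "h \<in> dom T" for h
    proof -
      have "h \<in> ?M"
        using that closure_subset by (rule subsetD[rotated])
      then have "cinner z h = 0"
        unfolding z_def by (rule orth_proj_orthogonal[OF M])
      then show ?thesis
        by (metis cinner_commute complex_cnj_zero)
    qed
    moreover have g: "\<forall>h\<in>dom T. cinner (the (T h)) f = cinner h g"
      using assms(2) by (auto simp: adj_def dest: op_of_graph_SomeD)
    ultimately have "\<forall>h\<in>dom T. cinner (the (T h)) f = cinner h (g + z)"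
      by (simp add: cinner.add_right)
    then have "g + z = g"
      using g ex1 by blast
    then have "x = orth_proj ?M x"
      by (simp add: z_def)
    then show ?thesis
      using orth_proj_in[OF M] by metis
  qed
  then show ?thesis
    by (auto simp: densely_defined_def)
qed


section \<open>Positive bounded operators and the A-adjoint\<close>

locale positive_bounded_op =
  fixes A :: "'h::chilbert_space \<Rightarrow> 'h"
  assumes clinear: "bounded_clinear A" and pos: "positive_op A"
begin

sublocale bounded_linear A
  using clinear by (simp add: bounded_clinear_def)

lemma scaleC: "A (c *\<^sub>C x) = c *\<^sub>C A x"
proof -
  interpret L: Vector_Spaces.linear "(*\<^sub>C)" "(*\<^sub>C)" A
    using clinear by (simp add: bounded_clinear_def)
  show ?thesis
    by (rule L.scale)
qed

lemma hermitian: "cinner (A x) y = cinner x (A y)"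
  by (rule positive_form_hermitian[OF add scaleC pos])

abbreviation M where "M \<equiv> closure (range A)"

lemma subspace_M: "complex_vector.subspace M"
proof (rule subspace_closure_complex, rule complex_vector.subspaceI)
  show "0 \<in> range A"
    using rangeI[of A 0] by (simp add: zero)
  show "x + y \<in> range A" if "x \<in> range A" "y \<in> range A" for x y
    using that by (auto simp flip: add)
  show "c *\<^sub>C x \<in> range A" if "x \<in> range A" for c x
    using that by (auto simp flip: scaleC)
qed

lemma P_in: "P_A A x \<in> M"
  by (rule orth_proj_in[OF subspace_M closed_closure])

text \<open>The error \<open>x - P_A A x\<close> is orthogonal to \<open>M\<close>, hence to
  \<open>A (A (x - P_A A x))\<close>; moving one \<open>A\<close> across the inner product shows
  that \<open>A\<close> kills it.\<close>

lemma A_P: "A (P_A A x) = A x"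
proof -
  have "A (A (x - P_A A x)) \<in> M"
    by (rule subsetD[OF closure_subset rangeI])
  then have "cinner (A (x - P_A A x)) (A (x - P_A A x)) = 0"
    unfolding hermitian by (rule orth_proj_orthogonal[OF subspace_M closed_closure])
  then show ?thesis
    by (simp add: cinner_eq_zero_iff diff)
qed

text \<open>By symmetry the null space of \<open>A\<close> is orthogonal to \<open>range A\<close>,
  hence to \<open>M\<close>; a vector in both is orthogonal to itself.\<close>

lemma inj_on_M:
  assumes "g \<in> M" "g' \<in> M" "A g = A g'"
  shows "g = g'"
proof -
  let ?z = "g - g'"
  have "?z \<in> M"
    by (rule complex_vector.subspace_diff[OF subspace_M assms(1,2)])
  moreover have "M \<subseteq> {y. cinner y ?z = 0}"
  proof (rule closure_minimal)
    show "range A \<subseteq> {y. cinner y ?z = 0}"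
      using assms(3) by (auto simp: hermitian diff cinner.zero_right)
    show "closed {y. cinner y ?z = 0}"
      by (intro closed_Collect_eq continuous_intros cinner.continuous_on)
  qed
  ultimately have "?z = 0"
    using cinner_eq_zero_iff by blast
  then show ?thesis
    by simp
qed

text \<open>Cauchy-Schwarz for the A-form at \<open>x\<close> and \<open>A x\<close> bounds the
  fourth power of \<open>norm (A x)\<close> by
  \<open>K * (norm (A x))\<^sup>2 * (norm_A A x)\<^sup>2\<close>; cancel the square. Thus A-seminorm
  convergence becomes norm convergence after applying \<open>A\<close>.\<close>

lemma norm_le_norm_A: "\<exists>K. \<forall>x. norm (A x) \<le> K * norm_A A x"
proof -
  obtain K where K: "\<And>x. norm (A x) \<le> norm x * K" "K \<ge> 0"
    using nonneg_bounded by blast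
  have nonneg: "Re (cinner (A z) z) \<ge> 0" for z
    using pos by (auto simp: positive_op_def complex_nonneg_Reals_iff)
  have "norm (A x) \<le> sqrt K * norm_A A x" for x
  proof (cases "A x = 0")
    case False
    let ?n = "norm (A x)"
    have "Re (cinner (A (A x)) (A x)) \<le> norm (A (A x)) * ?n"
      using norm_cinner_le complex_Re_le_cmod order_trans by blast
    also have "\<dots> \<le> ?n * K * ?n"
      by (intro mult_right_mono K) simp
    finally have le: "Re (cinner (A (A x)) (A x)) \<le> K * ?n\<^sup>2"
      by (simp add: power2_eq_square mult_ac)
    have "cmod (cinner (A x) (A x)) \<ge> ?n\<^sup>2"
      by (simp add: norm_power2_eq_cinner complex_Re_le_cmod)
    then have "(?n\<^sup>2)\<^sup>2 \<le> (cmod (cinner (A x) (A x)))\<^sup>2"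
      by (rule power_mono) simp
    also have "\<dots> \<le> Re (cinner (A x) x) * Re (cinner (A (A x)) (A x))"
      by (rule positive_form_Cauchy_Schwarz[OF add scaleC pos])
    also have "\<dots> \<le> Re (cinner (A x) x) * (K * ?n\<^sup>2)"
      by (intro mult_left_mono le nonneg)
    finally have "?n\<^sup>2 * ?n\<^sup>2 \<le> (K * Re (cinner (A x) x)) * ?n\<^sup>2"
      by (simp add: power2_eq_square mult_ac)
    then have "?n\<^sup>2 \<le> K * Re (cinner (A x) x)"
      by (rule mult_right_le_imp_le) (use False in simp)
    then have "?n \<le> sqrt (K * Re (cinner (A x) x))"
      by (rule real_le_rsqrt)
    then show ?thesis
      by (simp add: norm_A_def real_sqrt_mult)
  qed (simp add: norm_A_def cinner.zero_left)
  then show ?thesis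
    by blast
qed

lemma tendsto_if_norm_A:
  assumes "(\<lambda>k. norm_A A (u k - f)) \<longlonglongrightarrow> 0"
  shows "(\<lambda>k. A (u k)) \<longlonglongrightarrow> A f"
proof -
  obtain K where K: "\<And>x. norm (A x) \<le> K * norm_A A x"
    using norm_le_norm_A by blast
  have "(\<lambda>k. K * norm_A A (u k - f)) \<longlonglongrightarrow> 0"
    using tendsto_mult[OF tendsto_const assms, of K] by simp
  then have "(\<lambda>k. A (u k - f)) \<longlonglongrightarrow> 0"
    by (rule Lim_null_comparison[rotated]) (simp add: K)
  then show ?thesis
    by (simp add: diff Lim_null[of _ "A f"])
qed

section \<open>The A-adjoint: description through the adjoint, closedness, A-closedness\<close>

lemma A_adj_Some_iff:
  assumes dense: "densely_defined T"
  shows "A_adj A T f = Some g \<longleftrightarrow> g \<in> M \<and> adj T (A f) = Some (A g)"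
proof -
  let ?G = "{(f, g). g \<in> M \<and> (\<forall>h\<in>dom T. cinner_A A (the (T h)) f = cinner_A A h g)}"
  \<comment> \<open>Symmetry moves \<open>A\<close> to the second argument on both sides, which
    turns the defining relation into that of \<open>adj T\<close> at \<open>A f\<close>.\<close>
  have G: "(f, g) \<in> ?G \<longleftrightarrow> g \<in> M \<and> adj T (A f) = Some (A g)" for f g
    by (simp add: cinner_A_def hermitian adj_Some_iff[OF dense])
  have "single_valued ?G"
  proof (rule single_valuedI, unfold G)
    fix f g g'
    assume "g \<in> M \<and> adj T (A f) = Some (A g)" "g' \<in> M \<and> adj T (A f) = Some (A g')"
    then show "g = g'"
      using inj_on_M[of g g'] by simp
  qed
  then have "A_adj A T f = Some g \<longleftrightarrow> (f, g) \<in> ?G"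
    unfolding A_adj_def by (rule op_of_graph_Some_iff)
  then show ?thesis
    unfolding G .
qed

lemma closed_op_A_adj:
  assumes dense: "densely_defined T"
  shows "closed_op (A_adj A T)"
  unfolding closed_op_def
proof
  note iff = A_adj_Some_iff[OF dense] adj_Some_iff[OF dense]
  show "linear_op (A_adj A T)"
  proof (rule linear_opI)
    show "A_adj A T 0 = Some 0"
      using complex_vector.subspace_0[OF subspace_M]
      by (simp add: iff zero cinner.zero_right)
    show "A_adj A T (f + f') = Some (g + g')"
      if "A_adj A T f = Some g" "A_adj A T f' = Some g'" for f g f' g'
      using that complex_vector.subspace_add[OF subspace_M]
      by (simp add: iff add cinner.add_right)
    show "A_adj A T (c *\<^sub>C f) = Some (c *\<^sub>C g)" if "A_adj A T f = Some g" for c f g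
      using that complex_vector.subspace_scale[OF subspace_M]
      by (simp add: iff scaleC cinner_scaleC_right)
  qed
  \<comment> \<open>Each \<open>h\<close> contributes one equation between continuous functions of
    the pair, so the graph is an intersection of closed sets.\<close>
  have "Map.graph (A_adj A T) = {p. snd p \<in> M} \<inter>
      (\<Inter>h\<in>dom T. {p. cinner (the (T h)) (A (fst p)) = cinner h (A (snd p))})"
    unfolding set_eq_iff Map.graph_def by (simp add: iff split_paired_all)
  also have "closed \<dots>"
    by (intro closed_Int closed_INT ballI closed_Collect_eq continuous_intros cinner.continuous_on
        continuous_on closed_vimage[of M snd, unfolded vimage_def]) auto
  finally show "closed (Map.graph (A_adj A T))" .
qed

lemma A_closed_A_adj:
  assumes dense: "densely_defined T"
  shows "A_closed A (A_adj A T)"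
  unfolding A_closed_def
proof (intro conjI allI impI)
  note iff = A_adj_Some_iff[OF dense] adj_Some_iff[OF dense]
  let ?S = "A_adj A T"
  show "linear_op ?S"
    using closed_op_A_adj[OF dense] by (simp add: closed_op_def)
  fix u f g
  assume u: "range u \<subseteq> dom ?S \<inter> M" and "(\<lambda>k::nat. norm_A A (u k - f)) \<longlonglongrightarrow> 0"
    and "(\<lambda>k. norm_A A (the (?S (u k)) - g)) \<longlonglongrightarrow> 0"
  then have lim: "(\<lambda>k. A (u k)) \<longlonglongrightarrow> A f" "(\<lambda>k. A (the (?S (u k)))) \<longlonglongrightarrow> A g"
    by (auto intro: tendsto_if_norm_A)
  \<comment> \<open>The A-limit \<open>g\<close> may lie outside \<open>M\<close>; its projection
    lies in \<open>M\<close> and has the same image under \<open>A\<close>.\<close>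
  have "?S f = Some (P_A A g)"
    unfolding iff A_P
  proof (intro conjI P_in ballI)
    fix h assume h: "h \<in> dom T"
    have "cinner (the (T h)) (A (u k)) = cinner h (A (the (?S (u k))))" for k
    proof -
      obtain v where "?S (u k) = Some v"
        using u by blast
      moreover from this have "adj T (A (u k)) = Some (A v)"
        by (simp add: A_adj_Some_iff[OF dense])
      ultimately show ?thesis
        using h by (simp add: adj_Some_iff[OF dense])
    qed
    moreover have "(\<lambda>k. cinner (the (T h)) (A (u k))) \<longlonglongrightarrow> cinner (the (T h)) (A f)"
      by (intro cinner.tendsto tendsto_const lim)
    moreover have "(\<lambda>k. cinner h (A (the (?S (u k))))) \<longlonglongrightarrow> cinner h (A g)"
      by (intro cinner.tendsto tendsto_const lim)
    ultimately show "cinner (the (T h)) (A f) = cinner h (A g)"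
      using LIMSEQ_unique by simp
  qed
  then show "f \<in> dom ?S" "A (the (?S f) - g) = 0"
    by (auto simp: diff A_P)
qed

section \<open>Products with \<open>A\<close> and the second A-adjoint\<close>

lemma tot_comp_A_adj:
  assumes dense: "densely_defined T" and ran: "ran (adj T \<circ>\<^sub>m tot A) \<subseteq> range A"
  shows "tot A \<circ>\<^sub>m A_adj A T = adj T \<circ>\<^sub>m tot A"
proof (rule map_eqI)
  fix f k
  have "\<exists>g. A_adj A T f = Some g \<and> k = A g" if k: "adj T (A f) = Some k"
  proof -
    have "k \<in> ran (adj T \<circ>\<^sub>m tot A)"
      using k by (intro ranI) simp
    then obtain g where "k = A g"
      using ran by blast
    \<comment> \<open>The range condition provides some preimage of \<open>k\<close> under
      \<open>A\<close>; projecting it gives the preimage in \<open>M\<close> that the A-adjoint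
      requires.\<close>
    then show ?thesis
      using k by (intro exI[of _ "P_A A g"]) (simp add: A_adj_Some_iff[OF dense] A_P P_in)
  qed
  then show "(tot A \<circ>\<^sub>m A_adj A T) f = Some k \<longleftrightarrow> (adj T \<circ>\<^sub>m tot A) f = Some k"
    by (auto simp: tot_map_comp_Some A_adj_Some_iff[OF dense])
qed

text \<open>Symmetry of \<open>A\<close> makes both sides the same \<open>op_of_graph\<close>
  condition, uniqueness test included. The identity is therefore available for
  \<open>A_adj A T\<close> before its domain is known to be dense.\<close>

lemma adj_tot_comp: "adj (tot A \<circ>\<^sub>m S) = adj S \<circ>\<^sub>m tot A"
proof
  fix f
  have "dom (tot A \<circ>\<^sub>m S) = dom S"
    by (auto simp: dom_def tot_map_comp_Some)
  moreover have "the ((tot A \<circ>\<^sub>m S) h) = A (the (S h))" if "h \<in> dom S" for h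
    using that by (auto simp: map_comp_def)
  ultimately show "adj (tot A \<circ>\<^sub>m S) f = (adj S \<circ>\<^sub>m tot A) f"
    by (simp add: adj_def op_of_graph_def hermitian cong: ball_cong)
qed

text \<open>The adjoint relation extended to the closure, conjugated and with \<open>A\<close> moved
  across, says that \<open>A k\<close> is the value of the adjoint of \<open>A_adj A T\<close> at
  \<open>A f\<close>; \<open>P_A A k\<close> is the representative in \<open>M\<close>.\<close>

lemma P_op_closure_le:
  assumes dense: "densely_defined T" and "closable_op T" and dense': "densely_defined (A_adj A T)"
  shows "tot (P_A A) \<circ>\<^sub>m op_closure T \<subseteq>\<^sub>m A_adj A (A_adj A T)"
  unfolding map_le_def
proof
  fix f assume "f \<in> dom (tot (P_A A) \<circ>\<^sub>m op_closure T)"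
  then obtain k where k: "op_closure T f = Some k"
    by (auto simp: tot_map_comp_Some)
  have "cinner (the (A_adj A T h)) (A f) = cinner h (A k)" if h: "h \<in> dom (A_adj A T)" for h
  proof -
    obtain g where g: "A_adj A T h = Some g"
      using h by blast
    then have "cinner k (A h) = cinner f (A g)"
      using adj_op_closure[OF dense assms(2) k] by (simp add: A_adj_Some_iff[OF dense])
    then show ?thesis
      using g by (metis cinner_commute hermitian option.sel)
  qed
  then have "A_adj A (A_adj A T) f = Some (P_A A k)"
    by (simp add: A_adj_Some_iff[OF dense'] adj_Some_iff[OF dense'] A_P P_in)
  then show "(tot (P_A A) \<circ>\<^sub>m op_closure T) f = A_adj A (A_adj A T) f"
    using k by (simp add: map_comp_def)
qed

lemma tot_comp_P: "tot A \<circ>\<^sub>m (tot (P_A A) \<circ>\<^sub>m S) = tot A \<circ>\<^sub>m S"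
  by (rule map_eqI) (auto simp: tot_map_comp_Some A_P)

text \<open>An operator with values in \<open>M\<close> is recovered from its product with
  \<open>A\<close>, because \<open>A\<close> is injective there.\<close>

lemma P_comp_eq:
  assumes "ran S \<subseteq> M" "tot A \<circ>\<^sub>m S = tot A \<circ>\<^sub>m R"
  shows "S = tot (P_A A) \<circ>\<^sub>m R"
proof
  fix f
  \<comment> \<open>Comparing options carries equality of the domains along with equality of the
    values.\<close>
  have eq: "map_option A (S f) = map_option A (R f)"
    using fun_cong[OF assms(2), of f] by (simp add: map_comp_def split: option.splits)
  show "S f = (tot (P_A A) \<circ>\<^sub>m R) f"
  proof (cases "S f")
    case (Some g)
    then obtain k where k: "R f = Some k" "A g = A k"
      using eq by (cases "R f") auto
    have "g \<in> M"
      using Some assms(1) by (auto intro: ranI)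
    then have "g = P_A A k"
      by (rule inj_on_M[OF _ P_in]) (simp add: A_P k)
    then show ?thesis
      using Some k by (simp add: map_comp_def)
  qed (use eq in \<open>simp add: map_comp_def\<close>)
qed

end

theorem theorem3p10:
  fixes A :: "'h::chilbert_space \<Rightarrow> 'h" and T :: "'h \<rightharpoonup> 'h"
  assumes "bounded_clinear A" and "positive_op A"
    and "linear_op T" and "densely_defined T" and "closable_op T"
    and "ran (adj T \<circ>\<^sub>m tot A) \<subseteq> range A"
  shows "closed_op (A_adj A T) \<and>
    A_closed A (A_adj A T) \<and>
    (A_adj_exists A (A_adj A T) \<longrightarrow>
       tot (P_A A) \<circ>\<^sub>m op_closure T \<subseteq>\<^sub>m A_adj A (A_adj A T) \<and>
       tot A \<circ>\<^sub>m op_closure T \<subseteq>\<^sub>m tot A \<circ>\<^sub>m A_adj A (A_adj A T) \<and>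
       tot A \<circ>\<^sub>m A_adj A (A_adj A T) = adj (A_adj A T) \<circ>\<^sub>m tot A) \<and>
    (adj (adj T \<circ>\<^sub>m tot A) = tot A \<circ>\<^sub>m op_closure T \<longrightarrow>
       A_adj_exists A (A_adj A T) \<and>
       A_adj A (A_adj A T) = tot (P_A A) \<circ>\<^sub>m op_closure T \<and>
       tot A \<circ>\<^sub>m A_adj A (A_adj A T) = tot A \<circ>\<^sub>m op_closure T)"
proof -
  interpret positive_bounded_op A
    by unfold_locales fact+
  let ?S = "A_adj A T"
  let ?R = "A_adj A ?S"
  have closed: "closed_op ?S"
    by (rule closed_op_A_adj) fact
  have "tot (P_A A) \<circ>\<^sub>m op_closure T \<subseteq>\<^sub>m ?R \<and> tot A \<circ>\<^sub>m op_closure T \<subseteq>\<^sub>m tot A \<circ>\<^sub>m ?R \<and>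
      tot A \<circ>\<^sub>m ?R = adj ?S \<circ>\<^sub>m tot A" if "A_adj_exists A ?S"
  proof (intro conjI)
    have dense: "densely_defined ?S" and ran: "ran (adj ?S \<circ>\<^sub>m tot A) \<subseteq> range A"
      using that by (auto simp: A_adj_exists_def)
    show le: "tot (P_A A) \<circ>\<^sub>m op_closure T \<subseteq>\<^sub>m ?R"
      by (intro P_op_closure_le dense assms)
    then have "tot A \<circ>\<^sub>m (tot (P_A A) \<circ>\<^sub>m op_closure T) \<subseteq>\<^sub>m tot A \<circ>\<^sub>m ?R"
      by (fastforce simp: map_le_def map_comp_def dom_def split: option.splits)
    then show "tot A \<circ>\<^sub>m op_closure T \<subseteq>\<^sub>m tot A \<circ>\<^sub>m ?R"
      by (simp only: tot_comp_P)
    show "tot A \<circ>\<^sub>m ?R = adj ?S \<circ>\<^sub>m tot A"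
      by (rule tot_comp_A_adj[OF dense ran])
  qed
  moreover have "A_adj_exists A ?S \<and> ?R = tot (P_A A) \<circ>\<^sub>m op_closure T \<and>
      tot A \<circ>\<^sub>m ?R = tot A \<circ>\<^sub>m op_closure T"
    if eq: "adj (adj T \<circ>\<^sub>m tot A) = tot A \<circ>\<^sub>m op_closure T"
  proof -
    \<comment> \<open>Since \<open>A T\<^sup># = T\<^sup>* A\<close>, the left side of the
      hypothesis is the adjoint of \<open>A T\<^sup>#\<close>, that is
      \<open>(T\<^sup>#)\<^sup>* A\<close>.\<close>
    have adj_S: "adj ?S \<circ>\<^sub>m tot A = tot A \<circ>\<^sub>m op_closure T"
      using eq tot_comp_A_adj[OF assms(4,6)] adj_tot_comp[of ?S] by simp
    have lin: "linear_op ?S"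
      using closed by (simp add: closed_op_def)
    have "complex_vector.subspace (dom T)"
      using assms(3) by (simp add: linear_op_def)
    \<comment> \<open>A single point of \<open>dom T\<close> suffices: at its image under
      \<open>A\<close> the adjoint of \<open>?S\<close> is then defined, which forces
      \<open>?S\<close> to be densely defined.\<close>
    then obtain f where "f \<in> dom T"
      using complex_vector.subspace_0 by blast
    then have "(f, the (T f)) \<in> closure (Map.graph T)"
      using closure_subset[of "Map.graph T"] by (auto simp: Map.graph_def)
    then have "op_closure T f = Some (the (T f))"
      by (simp add: op_closure_Some_iff[OF assms(5)])
    then have "(adj ?S \<circ>\<^sub>m tot A) f = Some (A (the (T f)))"
      unfolding adj_S by (simp add: tot_map_comp_Some)
    then have dense: "densely_defined ?S"
      using lin by (auto simp: linear_op_def intro: densely_defined_if_adj_defined)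
    have ran: "ran (adj ?S \<circ>\<^sub>m tot A) \<subseteq> range A"
      unfolding adj_S by (auto simp: ran_def tot_map_comp_Some)
    \<comment> \<open>A closed graph is its own closure, hence still the graph of a
      function.\<close>
    have "closable_op ?S"
      using closed by (auto simp: closed_op_def closable_op_def single_valued_def Map.graph_def)
    then have ex: "A_adj_exists A ?S"
      by (simp add: A_adj_exists_def lin dense ran)
    have AR: "tot A \<circ>\<^sub>m ?R = tot A \<circ>\<^sub>m op_closure T"
      using tot_comp_A_adj[OF dense ran] adj_S by simp
    have "ran ?R \<subseteq> M"
      by (auto simp: ran_def A_adj_Some_iff[OF dense])
    then show ?thesis
      using ex AR P_comp_eq by blast
  qed
  ultimately show ?thesis
    using closed A_closed_A_adj[OF assms(4)] by blast
qed

end
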